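(* Let $X$ be a chain. (a) Let $S\in\{\mathcal{PO}(X),\mathcal{POI}(X)\}$ and $\alpha,\beta\in S$. Then $\alpha\,\mathcal{D}\,\beta$ in $S$ if and only if there exists an order-isomorphism $\theta:\mathrm{Im}(\alpha)\to\mathrm{Im}(\beta)$. (b) Let $S\in\{\mathcal{POP}(X),\mathcal{POPI}(X)\}$ and $\alpha,\beta\in S$. Then $\alpha\,\mathcal{D}\,\beta$ in $S$ if and only if there exists an orientation-preserving bijection $\theta:\mathrm{Im}(\alpha)\to\mathrm{Im}(\beta)$.
   Context: $X$ is a chain (totally ordered set), finite or infinite. $\mathcal{PT}(X)$ is the monoid of all partial transformations of $X$ (including the empty one) under composition of partial maps, written on the right: $x(\alpha\beta)=(x\alpha)\beta$, with $\mathrm{Dom}(\alpha\beta)=\{x\in\mathrm{Dom}(\alpha)\mid x\alpha\in\mathrm{Dom}(\beta)\}$. $\alpha\in\mathcal{PT}(X)$ is order-preserving on $Y\subseteq\mathrm{Dom}(\alpha)$ if $x\le y$ implies $x\alpha\le y\alpha$ for all $x,y\in Y$, and order-preserving if it is so on $\mathrm{Dom}(\alpha)$. $\alpha\in\mathcal{PT}(X)$ is orientation-preserving if it is the empty transformation or there exists a non-empty subset $Y$ of $\mathrm{Dom}(\alpha)$ such that: (OP1) $\alpha$ is order-preserving both on $Y$ and on $\mathrm{Dom}(\alpha)\setminus Y$; (OP2) for all $a\in Y$ and $b\in\mathrm{Dom}(\alpha)\setminus Y$, $a\le b$ and $a\alpha\ge b\alpha$. A map between subsets of $X$ is regarded as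 an element of $\mathcal{PT}(X)$ when calling it orientation-preserving. $\mathcal{PO}(X)$ and $\mathcal{POP}(X)$ are the submonoids of $\mathcal{PT}(X)$ of all order-preserving, respectively orientation-preserving, partial transformations; $\mathcal{POI}(X)$ and $\mathcal{POPI}(X)$ are their respective submonoids of injective elements. Green's relations on a monoid $S$: $\alpha\,\mathcal{L}\,\beta$ iff $S\alpha=S\beta$; $\alpha\,\mathcal{R}\,\beta$ iff $\alpha S=\beta S$; $\alpha\,\mathcal{D}\,\beta$ iff there is $\gamma\in S$ with $\alpha\,\mathcal{R}\,\gamma$ and $\gamma\,\mathcal{L}\,\beta$. *)

theory Defs
  imports "HOL-Algebra.Coset"
begin

text \<open>
  The chain is an arbitrary (possibly empty) set \<open>X\<close> of elements of a linearly ordered type, with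
  the induced order. Partial transformations are maps \<open>\<alpha> :: 'a \<rightharpoonup> 'a\<close>; \<open>dom \<alpha>\<close> and \<open>ran \<alpha>\<close>
  are the domain and the image.
\<close>

text \<open>Maps act on the right, so the product of \<open>\<alpha>\<close> and \<open>\<beta>\<close> applies \<open>\<alpha>\<close> first.\<close>

definition PT :: "'a set \<Rightarrow> ('a \<rightharpoonup> 'a) monoid" where
  "PT X = \<lparr>carrier = {\<alpha>. dom \<alpha> \<subseteq> X \<and> ran \<alpha> \<subseteq> X},
           monoid.mult = (\<lambda>\<alpha> \<beta>. \<beta> \<circ>\<^sub>m \<alpha>),
           one = Some |` X\<rparr>"

definition order_preserving_on :: "'a::linorder set \<Rightarrow> ('a \<rightharpoonup> 'a) \<Rightarrow> bool" where
  "order_preserving_on Y \<alpha> \<longleftrightarrow> Y \<subseteq> dom \<alpha> \<and> mono_on Y (\<lambda>x. the (\<alpha> x))"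

definition order_preserving :: "('a::linorder \<rightharpoonup> 'a) \<Rightarrow> bool" where
  "order_preserving \<alpha> \<longleftrightarrow> order_preserving_on (dom \<alpha>) \<alpha>"

definition orientation_preserving :: "('a::linorder \<rightharpoonup> 'a) \<Rightarrow> bool" where
  "orientation_preserving \<alpha> \<longleftrightarrow>
     \<alpha> = Map.empty \<or>
     (\<exists>Y. Y \<noteq> {} \<and> Y \<subseteq> dom \<alpha> \<and>
        order_preserving_on Y \<alpha> \<and> order_preserving_on (dom \<alpha> - Y) \<alpha> \<and>
        (\<forall>a\<in>Y. \<forall>b\<in>dom \<alpha> - Y. a \<le> b \<and> the (\<alpha> a) \<ge> the (\<alpha> b)))"

definition PO :: "'a::linorder set \<Rightarrow> ('a \<rightharpoonup> 'a) monoid" where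
  "PO X = (PT X)\<lparr>carrier := {\<alpha> \<in> carrier (PT X). order_preserving \<alpha>}\<rparr>"

definition POP :: "'a::linorder set \<Rightarrow> ('a \<rightharpoonup> 'a) monoid" where
  "POP X = (PT X)\<lparr>carrier := {\<alpha> \<in> carrier (PT X). orientation_preserving \<alpha>}\<rparr>"

definition POI :: "'a::linorder set \<Rightarrow> ('a \<rightharpoonup> 'a) monoid" where
  "POI X = (PO X)\<lparr>carrier := {\<alpha> \<in> carrier (PO X). inj_on \<alpha> (dom \<alpha>)}\<rparr>"

definition POPI :: "'a::linorder set \<Rightarrow> ('a \<rightharpoonup> 'a) monoid" where
  "POPI X = (POP X)\<lparr>carrier := {\<alpha> \<in> carrier (POP X). inj_on \<alpha> (dom \<alpha>)}\<rparr>"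

definition green_L :: "('b, 'c) monoid_scheme \<Rightarrow> 'b \<Rightarrow> 'b \<Rightarrow> bool" where
  "green_L S a b \<longleftrightarrow> carrier S #>\<^bsub>S\<^esub> a = carrier S #>\<^bsub>S\<^esub> b"

definition green_R :: "('b, 'c) monoid_scheme \<Rightarrow> 'b \<Rightarrow> 'b \<Rightarrow> bool" where
  "green_R S a b \<longleftrightarrow> a <#\<^bsub>S\<^esub> carrier S = b <#\<^bsub>S\<^esub> carrier S"

definition green_D :: "('b, 'c) monoid_scheme \<Rightarrow> 'b \<Rightarrow> 'b \<Rightarrow> bool" where
  "green_D S a b \<longleftrightarrow> (\<exists>c\<in>carrier S. green_R S a c \<and> green_L S c b)"

text \<open>A bijection between subsets of \<open>X\<close> is itself a partial transformation, with domain exactly \<open>A\<close>.\<close>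

definition partial_bij :: "('a \<rightharpoonup> 'a) \<Rightarrow> 'a set \<Rightarrow> 'a set \<Rightarrow> bool" where
  "partial_bij \<theta> A B \<longleftrightarrow> dom \<theta> = A \<and> bij_betw (\<lambda>x. the (\<theta> x)) A B"

definition order_iso :: "('a::linorder \<rightharpoonup> 'a) \<Rightarrow> 'a set \<Rightarrow> 'a set \<Rightarrow> bool" where
  "order_iso \<theta> A B \<longleftrightarrow>
     partial_bij \<theta> A B \<and> (\<forall>x\<in>A. \<forall>y\<in>A. x \<le> y \<longleftrightarrow> the (\<theta> x) \<le> the (\<theta> y))"

end

theory Submission
  imports Defs
begin

text \<open>
  All four monoids consist of the partial transformations of \<open>X\<close> that satisfy a property \<open>P\<close> which
  holds for partial identities, is inherited by products, and passes from a map \<open>f\<close> to a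
  section of \<open>f\<close>, that is, a map that picks one preimage for every point of the image.

  Sections make Green's relation \<open>\<L>\<close> as coarse as it can be: if \<open>\<alpha>\<close> and \<open>\<beta>\<close> have the
  same image and \<open>s\<close> is a section of \<open>\<beta>\<close>, then \<open>\<alpha> = (\<alpha>s)\<beta>\<close>, so \<open>\<L>\<close> is equality of images.
  If \<open>\<alpha>\<close> and \<open>\<gamma>\<close> are \<open>\<R>\<close>-related, the right multipliers that take \<open>\<alpha>\<close> to \<open>\<gamma>\<close> and back restrict
  to mutually inverse bijections between the two images, and restriction is multiplication by a
  partial identity. Conversely a bijection \<open>\<theta>\<close> with property \<open>P\<close> from the image of \<open>\<alpha>\<close> has its
  inverse as section, whence \<open>\<alpha> \<R> \<alpha>\<theta>\<close>. Together, \<open>\<alpha> \<D> \<beta>\<close> means that the images are linked by a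
  bijection satisfying \<open>P\<close>.

  What remains is to verify the closure properties. Only products of orientation-preserving
  maps need thought: the two cuts divide the domain of the product into at most three consecutive
  pieces, two of which merge.
\<close>

section \<open>Sections of partial maps\<close>

definition map_section :: "('a \<rightharpoonup> 'b) \<Rightarrow> 'b \<rightharpoonup> 'a" where
  "map_section f y = (if y \<in> ran f then Some (SOME x. f x = Some y) else None)"

lemma map_section_SomeD: "map_section f y = Some x \<Longrightarrow> f x = Some y"
  by (auto simp: map_section_def ran_def split: if_splits intro: someI)

lemma dom_map_section [simp]: "dom (map_section f) = ran f"
  by (auto simp: map_section_def dom_def)

lemma ran_map_section_subset: "ran (map_section f) \<subseteq> dom f"
  by (auto simp: ran_def dest: map_section_SomeD)

lemma map_section_inj: "inj_on (map_section f) (dom (map_section f))"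
proof (rule inj_onI)
  fix y z
  assume "y \<in> dom (map_section f)" and eq: "map_section f y = map_section f z"
  then obtain x where "map_section f y = Some x"
    by blast
  with eq show "y = z"
    by (metis map_section_SomeD option.inject)
qed

lemma map_section_cancel:
  assumes "ran f \<subseteq> ran g"
  shows "g \<circ>\<^sub>m (map_section g \<circ>\<^sub>m f) = f"
proof
  fix x
  show "(g \<circ>\<^sub>m (map_section g \<circ>\<^sub>m f)) x = f x"
  proof (cases "f x")
    case (Some y)
    then have "y \<in> ran g"
      using assms by (auto simp: ran_def)
    then obtain z where z: "map_section g y = Some z"
      by (metis dom_map_section domD)
    with Some map_section_SomeD[OF z] show ?thesis
      by simp
  qed simp
qed

lemma map_section_left_inverse:
  assumes "inj_on g (dom g)" and "g x = Some y"
  shows "map_section g y = Some x"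
proof -
  have "y \<in> ran g"
    using assms(2) by (auto simp: ran_def)
  then obtain z where z: "map_section g y = Some z"
    by (metis dom_map_section domD)
  with assms show ?thesis
    by (metis domI inj_onD map_section_SomeD)
qed

lemma map_section_comp_inj:
  assumes "inj_on g (dom g)" and "ran f \<subseteq> dom g"
  shows "map_section g \<circ>\<^sub>m (g \<circ>\<^sub>m f) = f"
proof
  fix x
  show "(map_section g \<circ>\<^sub>m (g \<circ>\<^sub>m f)) x = f x"
  proof (cases "f x")
    case (Some y)
    then obtain z where "g y = Some z"
      using assms(2) by (force simp: ran_def)
    with Some show ?thesis
      by (simp add: map_section_left_inverse[OF assms(1)])
  qed simp
qed

lemma dom_map_comp_subset: "dom (g \<circ>\<^sub>m f) \<subseteq> dom f"
  by (auto simp: map_comp_Some_iff)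

lemma ran_map_comp_subset: "ran (g \<circ>\<^sub>m f) \<subseteq> ran g"
  by (auto simp: ran_def map_comp_Some_iff)

lemma ran_map_comp_onto: "dom g \<subseteq> ran f \<Longrightarrow> ran (g \<circ>\<^sub>m f) = ran g"
proof (intro subset_antisym ran_map_comp_subset subsetI)
  fix z
  assume "dom g \<subseteq> ran f" "z \<in> ran g"
  then obtain x y where "g y = Some z" "f x = Some y"
    unfolding ran_def by blast
  then show "z \<in> ran (g \<circ>\<^sub>m f)"
    by (intro ranI[of _ x]) simp
qed

lemma restrict_map_eq_comp: "f |` A = f \<circ>\<^sub>m (Some |` A)"
  by (auto simp: restrict_map_def map_comp_def fun_eq_iff)

lemma map_comp_identity_left: "dom f \<subseteq> X \<Longrightarrow> f \<circ>\<^sub>m (Some |` X) = f"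
  unfolding restrict_map_eq_comp[symmetric]
  by (rule map_le_antisym) (auto simp: map_le_def restrict_map_def)

lemma map_comp_identity_right: "ran f \<subseteq> X \<Longrightarrow> (Some |` X) \<circ>\<^sub>m f = f"
  by (auto simp: restrict_map_def map_comp_def fun_eq_iff ran_def split: option.split)

lemma map_comp_assoc: "(h \<circ>\<^sub>m g) \<circ>\<^sub>m f = h \<circ>\<^sub>m (g \<circ>\<^sub>m f)"
  by (auto simp: map_comp_def fun_eq_iff split: option.split)

lemma partial_bij_iff: "partial_bij \<theta> A B \<longleftrightarrow> dom \<theta> = A \<and> ran \<theta> = B \<and> inj_on \<theta> (dom \<theta>)"
proof -
  have "(\<lambda>x. the (\<theta> x)) ` dom \<theta> = ran \<theta>"
    by (force simp: ran_def)
  moreover have "the (\<theta> x) = the (\<theta> y) \<longleftrightarrow> \<theta> x = \<theta> y" if "x \<in> dom \<theta>" "y \<in> dom \<theta>" for x y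
    using that by auto
  then have "inj_on (\<lambda>x. the (\<theta> x)) (dom \<theta>) \<longleftrightarrow> inj_on \<theta> (dom \<theta>)"
    by (simp add: inj_on_def)
  ultimately show ?thesis
    unfolding partial_bij_def bij_betw_def by (cases "dom \<theta> = A") auto
qed

section \<open>Green's relations in section-closed transformation monoids\<close>

locale section_closed =
  fixes P :: "('a \<rightharpoonup> 'a) \<Rightarrow> bool"
  assumes partial_identity: "P (Some |` A)"
    and comp: "P f \<Longrightarrow> P g \<Longrightarrow> P (g \<circ>\<^sub>m f)"
    and preimages: "P f \<Longrightarrow> P (map_section f)"
begin

definition transformations :: "'a set \<Rightarrow> ('a \<rightharpoonup> 'a) monoid" where
  "transformations X = (PT X)\<lparr>carrier := {\<alpha> \<in> carrier (PT X). P \<alpha>}\<rparr>"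

lemma carrier_iff: "f \<in> carrier (transformations X) \<longleftrightarrow> dom f \<subseteq> X \<and> ran f \<subseteq> X \<and> P f"
  by (simp add: transformations_def PT_def)

lemma mult_eq [simp]: "f \<otimes>\<^bsub>transformations X\<^esub> g = g \<circ>\<^sub>m f"
  by (simp add: transformations_def PT_def)

lemma comp_closed:
  assumes "f \<in> carrier (transformations X)" "g \<in> carrier (transformations X)"
  shows "g \<circ>\<^sub>m f \<in> carrier (transformations X)"
  using assms comp dom_map_comp_subset[of g f] ran_map_comp_subset[of g f]
  unfolding carrier_iff by blast

lemma identity_closed: "Some |` X \<in> carrier (transformations X)"
  using partial_identity by (auto simp: carrier_iff ran_def restrict_map_def split: if_splits)

lemma map_section_closed:
  "f \<in> carrier (transformations X) \<Longrightarrow> map_section f \<in> carrier (transformations X)"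
  using preimages ran_map_section_subset[of f] by (auto simp: carrier_iff)

lemma left_ideal_iff:
  "h \<in> carrier (transformations X) #>\<^bsub>transformations X\<^esub> f \<longleftrightarrow>
    (\<exists>d\<in>carrier (transformations X). h = f \<circ>\<^sub>m d)"
  by (auto simp: r_coset_def)

lemma right_ideal_iff:
  "h \<in> f <#\<^bsub>transformations X\<^esub> carrier (transformations X) \<longleftrightarrow>
    (\<exists>d\<in>carrier (transformations X). h = d \<circ>\<^sub>m f)"
  by (auto simp: l_coset_def)

lemma left_ideal_subset_iff:
  assumes "f \<in> carrier (transformations X)"
  shows "carrier (transformations X) #>\<^bsub>transformations X\<^esub> f
      \<subseteq> carrier (transformations X) #>\<^bsub>transformations X\<^esub> g \<longleftrightarrow>
    (\<exists>d\<in>carrier (transformations X). f = g \<circ>\<^sub>m d)"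
    (is "?I f \<subseteq> ?I g \<longleftrightarrow> _")
proof
  assume "?I f \<subseteq> ?I g"
  moreover have "f \<in> ?I f"
    using assms map_comp_identity_left[of f X] identity_closed[of X]
    unfolding left_ideal_iff carrier_iff[of f]
    by (intro bexI[of _ "Some |` X"]) simp_all
  ultimately show "\<exists>d\<in>carrier (transformations X). f = g \<circ>\<^sub>m d"
    unfolding left_ideal_iff[symmetric] by blast
next
  assume "\<exists>d\<in>carrier (transformations X). f = g \<circ>\<^sub>m d"
  then obtain d where d: "d \<in> carrier (transformations X)" "f = g \<circ>\<^sub>m d"
    by blast
  show "?I f \<subseteq> ?I g"
  proof
    fix h
    assume "h \<in> ?I f"
    then obtain k where "k \<in> carrier (transformations X)" "h = f \<circ>\<^sub>m k"
      unfolding left_ideal_iff by blast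
    with d show "h \<in> ?I g"
      unfolding left_ideal_iff
      by (intro bexI[of _ "d \<circ>\<^sub>m k"]) (simp_all add: map_comp_assoc comp_closed)
  qed
qed

lemma green_L_iff_factors:
  assumes "f \<in> carrier (transformations X)" "g \<in> carrier (transformations X)"
  shows "green_L (transformations X) f g \<longleftrightarrow>
    (\<exists>d\<in>carrier (transformations X). f = g \<circ>\<^sub>m d) \<and>
    (\<exists>e\<in>carrier (transformations X). g = f \<circ>\<^sub>m e)"
  unfolding green_L_def set_eq_subset left_ideal_subset_iff[OF assms(1)]
    left_ideal_subset_iff[OF assms(2)] ..

lemma right_ideal_subset_iff:
  assumes "f \<in> carrier (transformations X)"
  shows "f <#\<^bsub>transformations X\<^esub> carrier (transformations X)
      \<subseteq> g <#\<^bsub>transformations X\<^esub> carrier (transformations X) \<longleftrightarrow>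
    (\<exists>d\<in>carrier (transformations X). f = d \<circ>\<^sub>m g)"
    (is "?I f \<subseteq> ?I g \<longleftrightarrow> _")
proof
  assume "?I f \<subseteq> ?I g"
  moreover have "f \<in> ?I f"
    using assms map_comp_identity_right[of f X] identity_closed[of X]
    unfolding right_ideal_iff carrier_iff[of f]
    by (intro bexI[of _ "Some |` X"]) simp_all
  ultimately show "\<exists>d\<in>carrier (transformations X). f = d \<circ>\<^sub>m g"
    unfolding right_ideal_iff[symmetric] by blast
next
  assume "\<exists>d\<in>carrier (transformations X). f = d \<circ>\<^sub>m g"
  then obtain d where d: "d \<in> carrier (transformations X)" "f = d \<circ>\<^sub>m g"
    by blast
  show "?I f \<subseteq> ?I g"
  proof
    fix h
    assume "h \<in> ?I f"
    then obtain k where "k \<in> carrier (transformations X)" "h = k \<circ>\<^sub>m f"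
      unfolding right_ideal_iff by blast
    with d show "h \<in> ?I g"
      unfolding right_ideal_iff
      by (intro bexI[of _ "k \<circ>\<^sub>m d"]) (simp_all add: map_comp_assoc comp_closed)
  qed
qed

lemma green_R_iff_factors:
  assumes "f \<in> carrier (transformations X)" "g \<in> carrier (transformations X)"
  shows "green_R (transformations X) f g \<longleftrightarrow>
    (\<exists>d\<in>carrier (transformations X). f = d \<circ>\<^sub>m g) \<and>
    (\<exists>e\<in>carrier (transformations X). g = e \<circ>\<^sub>m f)"
  unfolding green_R_def set_eq_subset right_ideal_subset_iff[OF assms(1)]
    right_ideal_subset_iff[OF assms(2)] ..

text \<open>
  When the images agree, sending each point \<open>x\<close> to the chosen \<open>g\<close>-preimage of \<open>f x\<close> factors \<open>f\<close>
  through \<open>g\<close>.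
\<close>

lemma green_L_iff_ran_eq:
  assumes "f \<in> carrier (transformations X)" "g \<in> carrier (transformations X)"
  shows "green_L (transformations X) f g \<longleftrightarrow> ran f = ran g"
proof
  assume "green_L (transformations X) f g"
  then show "ran f = ran g"
    unfolding green_L_iff_factors[OF assms] using ran_map_comp_subset by (metis subset_antisym)
next
  have "\<exists>d\<in>carrier (transformations X). h = k \<circ>\<^sub>m d"
    if "h \<in> carrier (transformations X)" "k \<in> carrier (transformations X)" "ran h = ran k" for h k
    using that by (intro bexI[of _ "map_section k \<circ>\<^sub>m h"])
      (simp_all add: map_section_cancel map_section_closed comp_closed)
  then show "green_L (transformations X) f g" if "ran f = ran g"
    unfolding green_L_iff_factors[OF assms] using assms that by metis
qed

text \<open>
  A right multiplier \<open>e\<close> with \<open>g = fe\<close> and \<open>f = gd\<close> may act arbitrarily outside the image of \<open>f\<close>;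
  on that image it is undone by \<open>d\<close>, hence injective there.
\<close>

lemma green_R_imp_partial_bij:
  assumes "f \<in> carrier (transformations X)" "g \<in> carrier (transformations X)"
    and "green_R (transformations X) f g"
  shows "\<exists>\<theta>. partial_bij \<theta> (ran f) (ran g) \<and> P \<theta>"
proof -
  obtain d e where d: "f = d \<circ>\<^sub>m g" and e: "e \<in> carrier (transformations X)" "g = e \<circ>\<^sub>m f"
    using assms(3) unfolding green_R_iff_factors[OF assms(1,2)] by blast
  have undo: "\<exists>z. e y = Some z \<and> d z = Some y \<and> z \<in> ran g" if y: "y \<in> ran f" for y
  proof -
    obtain x where x: "f x = Some y"
      using y unfolding ran_def by blast
    then have "(d \<circ>\<^sub>m g) x = Some y"
      using d by simp
    then obtain z where "g x = Some z" "d z = Some y"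
      by (auto simp: map_comp_Some_iff)
    moreover from this have "e y = Some z"
      using e(2) x by (metis map_comp_simps(2))
    ultimately show ?thesis
      by (auto simp: ran_def)
  qed
  let ?\<theta> = "e |` ran f"
  have "dom ?\<theta> = ran f"
    using undo by auto
  moreover have "ran ?\<theta> = ran g"
  proof
    show "ran ?\<theta> \<subseteq> ran g"
      using undo by (force simp: ran_def restrict_map_def split: if_splits)
    have "g = ?\<theta> \<circ>\<^sub>m f"
      by (subst e(2)) (auto simp: map_comp_def restrict_map_def fun_eq_iff ran_def
          split: option.split)
    then show "ran g \<subseteq> ran ?\<theta>"
      by (metis ran_map_comp_subset)
  qed
  moreover have "inj_on ?\<theta> (dom ?\<theta>)"
    using undo by (auto simp: inj_on_def restrict_map_def split: if_splits)
      (metis option.inject)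
  moreover have "P ?\<theta>"
    using e(1) partial_identity comp by (simp add: restrict_map_eq_comp[of e] carrier_iff)
  ultimately show ?thesis
    unfolding partial_bij_iff by blast
qed

lemma green_R_comp_partial_bij:
  assumes f: "f \<in> carrier (transformations X)" and \<theta>: "\<theta> \<in> carrier (transformations X)"
    and "inj_on \<theta> (dom \<theta>)" "ran f \<subseteq> dom \<theta>"
  shows "green_R (transformations X) f (\<theta> \<circ>\<^sub>m f)"
  unfolding green_R_iff_factors[OF f comp_closed[OF f \<theta>]]
  using map_section_comp_inj[OF assms(3,4)] map_section_closed[OF \<theta>] \<theta> by metis

theorem green_D_iff_partial_bij:
  assumes f: "f \<in> carrier (transformations X)" and g: "g \<in> carrier (transformations X)"
  shows "green_D (transformations X) f g \<longleftrightarrow> (\<exists>\<theta>. partial_bij \<theta> (ran f) (ran g) \<and> P \<theta>)"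
proof
  assume "green_D (transformations X) f g"
  then obtain h where h: "h \<in> carrier (transformations X)"
    "green_R (transformations X) f h" "green_L (transformations X) h g"
    unfolding green_D_def by blast
  then have "ran h = ran g"
    using g green_L_iff_ran_eq by blast
  then show "\<exists>\<theta>. partial_bij \<theta> (ran f) (ran g) \<and> P \<theta>"
    using green_R_imp_partial_bij[OF f h(1,2)] by simp
next
  assume "\<exists>\<theta>. partial_bij \<theta> (ran f) (ran g) \<and> P \<theta>"
  then obtain \<theta> where dom: "dom \<theta> = ran f" and ran: "ran \<theta> = ran g"
    and inj: "inj_on \<theta> (dom \<theta>)" and "P \<theta>"
    by (auto simp: partial_bij_iff)
  then have \<theta>: "\<theta> \<in> carrier (transformations X)"
    using f g by (simp add: carrier_iff)
  let ?h = "\<theta> \<circ>\<^sub>m f"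
  have h: "?h \<in> carrier (transformations X)"
    using comp_closed[OF f \<theta>] .
  moreover have "green_R (transformations X) f ?h"
    using green_R_comp_partial_bij[OF f \<theta> inj] dom by simp
  moreover have "green_L (transformations X) ?h g"
    using green_L_iff_ran_eq[OF h g] ran_map_comp_onto[of \<theta> f] dom ran by simp
  ultimately show "green_D (transformations X) f g"
    unfolding green_D_def by blast
qed

end

text \<open>
  Injectivity is inherited by products and holds for every section, so each closed property yields
  a closed property of injective maps.
\<close>

lemma section_closed_injective:
  assumes "section_closed P"
  shows "section_closed (\<lambda>f. P f \<and> inj_on f (dom f))"
proof -
  interpret section_closed P
    by fact
  show ?thesis
  proof
    show "P (Some |` A) \<and> inj_on (Some |` A) (dom (Some |` A))" for A
      by (auto simp: partial_identity inj_on_def)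
    show "P (map_section f) \<and> inj_on (map_section f) (dom (map_section f))"
      if "P f \<and> inj_on f (dom f)" for f
      using that preimages map_section_inj by blast
    fix f g
    assume f: "P f \<and> inj_on f (dom f)" and g: "P g \<and> inj_on g (dom g)"
    have "x = y" if "(g \<circ>\<^sub>m f) x = Some z" "(g \<circ>\<^sub>m f) y = Some z" for x y z
    proof -
      from that obtain u v where "f x = Some u" "g u = Some z" "f y = Some v" "g v = Some z"
        by (auto simp: map_comp_Some_iff)
      with f g show ?thesis
        by (metis domI inj_onD)
    qed
    then have "inj_on (g \<circ>\<^sub>m f) (dom (g \<circ>\<^sub>m f))"
      by (metis domD inj_onI)
    with f g comp show "P (g \<circ>\<^sub>m f) \<and> inj_on (g \<circ>\<^sub>m f) (dom (g \<circ>\<^sub>m f))"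
      by blast
  qed
qed

section \<open>Order-preserving maps\<close>

lemma order_preserving_iff:
  "order_preserving f \<longleftrightarrow> (\<forall>x y u v. f x = Some u \<longrightarrow> f y = Some v \<longrightarrow> x \<le> y \<longrightarrow> u \<le> v)"
  by (force simp: order_preserving_def order_preserving_on_def mono_on_def)

lemma section_closed_order_preserving: "section_closed order_preserving"
proof
  show "order_preserving (Some |` A)" for A :: "'a set"
    by (auto simp: order_preserving_iff restrict_map_def split: if_splits)
  show "order_preserving (g \<circ>\<^sub>m f)" if "order_preserving f" "order_preserving g"
    for f g :: "'a \<rightharpoonup> 'a"
    using that unfolding order_preserving_iff map_comp_Some_iff by blast
  show "order_preserving (map_section f)" if "order_preserving f" for f :: "'a \<rightharpoonup> 'a"
    unfolding order_preserving_iff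
  proof (intro allI impI)
    fix y z u v
    assume *: "map_section f y = Some u" "map_section f z = Some v" "y \<le> z"
    show "u \<le> v"
    proof (rule ccontr)
      assume "\<not> u \<le> v"
      then have "z \<le> y"
        using that *(1,2)[THEN map_section_SomeD] linear[of u v]
        unfolding order_preserving_iff by blast
      with * \<open>\<not> u \<le> v\<close> show False
        by simp
    qed
  qed
qed

lemma order_iso_iff: "order_iso \<theta> A B \<longleftrightarrow> partial_bij \<theta> A B \<and> order_preserving \<theta>"
proof
  assume "order_iso \<theta> A B"
  then show "partial_bij \<theta> A B \<and> order_preserving \<theta>"
    by (auto simp: order_iso_def partial_bij_def order_preserving_def order_preserving_on_def
        mono_on_def)
next
  assume *: "partial_bij \<theta> A B \<and> order_preserving \<theta>"
  then have dom: "dom \<theta> = A" and inj: "inj_on (\<lambda>x. the (\<theta> x)) A"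
    and mono: "mono_on A (\<lambda>x. the (\<theta> x))"
    by (auto simp: partial_bij_def bij_betw_def order_preserving_def order_preserving_on_def)
  have "x \<le> y \<longleftrightarrow> the (\<theta> x) \<le> the (\<theta> y)" if "x \<in> A" "y \<in> A" for x y
  proof
    assume le: "the (\<theta> x) \<le> the (\<theta> y)"
    show "x \<le> y"
    proof (rule ccontr)
      assume "\<not> x \<le> y"
      then have "y \<le> x" "x \<noteq> y"
        by auto
      with mono_onD[OF mono that(2,1)] le have "the (\<theta> x) = the (\<theta> y)"
        by simp
      with inj_onD[OF inj _ that] \<open>x \<noteq> y\<close> show False
        by blast
    qed
  qed (rule mono_onD[OF mono that])
  with * show "order_iso \<theta> A B"
    by (simp add: order_iso_def)
qed

section \<open>Orientation-preserving maps\<close>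

text \<open>
  The set \<open>Y\<close> cuts the domain after the segment where the map has not yet wrapped around. It may
  miss the domain altogether and may contain points outside it: this absorbs the exceptional role
  of the empty map and lets one cut serve for all restrictions of a map.
\<close>

definition wraps_at :: "'a::linorder set \<Rightarrow> ('a \<rightharpoonup> 'a) \<Rightarrow> bool" where
  "wraps_at Y f \<longleftrightarrow> (\<forall>x y u v. f x = Some u \<longrightarrow> f y = Some v \<longrightarrow>
     (x \<in> Y \<longleftrightarrow> y \<in> Y) \<and> x \<le> y \<longrightarrow> u \<le> v) \<and>
   (\<forall>x y u v. f x = Some u \<longrightarrow> f y = Some v \<longrightarrow> x \<in> Y \<longrightarrow> y \<notin> Y \<longrightarrow> x \<le> y \<and> v \<le> u)"

lemma wraps_at_same:
  "wraps_at Y f \<Longrightarrow> f x = Some u \<Longrightarrow> f y = Some v \<Longrightarrow> x \<in> Y \<longleftrightarrow> y \<in> Y \<Longrightarrow> x \<le> y \<Longrightarrow> u \<le> v"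
  unfolding wraps_at_def by blast

lemma wraps_at_split:
  "wraps_at Y f \<Longrightarrow> f x = Some u \<Longrightarrow> f y = Some v \<Longrightarrow> x \<in> Y \<Longrightarrow> y \<notin> Y \<Longrightarrow> x \<le> y \<and> v \<le> u"
  unfolding wraps_at_def by blast

lemma wraps_atI:
  assumes "\<And>x y u v. f x = Some u \<Longrightarrow> f y = Some v \<Longrightarrow> x \<in> Y \<longleftrightarrow> y \<in> Y \<Longrightarrow> x \<le> y \<Longrightarrow> u \<le> v"
    and "\<And>x y u v. f x = Some u \<Longrightarrow> f y = Some v \<Longrightarrow> x \<in> Y \<Longrightarrow> y \<notin> Y \<Longrightarrow> x \<le> y \<and> v \<le> u"
  shows "wraps_at Y f"
  using assms unfolding wraps_at_def by blast

lemma orientation_preserving_iff: "orientation_preserving f \<longleftrightarrow> (\<exists>Y. wraps_at Y f)"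
proof
  assume "orientation_preserving f"
  then consider "f = Map.empty" | Y where "Y \<subseteq> dom f" "order_preserving_on Y f"
    "order_preserving_on (dom f - Y) f"
    "\<forall>a\<in>Y. \<forall>b\<in>dom f - Y. a \<le> b \<and> the (f a) \<ge> the (f b)"
    unfolding orientation_preserving_def by blast
  then show "\<exists>Y. wraps_at Y f"
  proof cases
    case 1
    then show ?thesis
      by (simp add: wraps_at_def)
  next
    case 2
    have "wraps_at Y f"
    proof (rule wraps_atI)
      show "u \<le> v" if "f x = Some u" "f y = Some v" "x \<in> Y \<longleftrightarrow> y \<in> Y" "x \<le> y" for x y u v
        using 2(2,3) that unfolding order_preserving_on_def mono_on_def
        by (cases "x \<in> Y") (metis option.sel, metis DiffI domI option.sel)
      show "x \<le> y \<and> v \<le> u" if "f x = Some u" "f y = Some v" "x \<in> Y" "y \<notin> Y" for x y u v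
        using 2(4) that by (metis DiffI domI option.sel)
    qed
    then show ?thesis ..
  qed
next
  assume "\<exists>Y. wraps_at Y f"
  then obtain Y where Y: "wraps_at Y f" ..
  have op: "order_preserving_on Z f" if "Z \<subseteq> dom f" "Z \<subseteq> Y \<or> Z \<inter> Y = {}" for Z
    unfolding order_preserving_on_def
  proof (intro conjI mono_onI)
    fix x y
    assume "x \<in> Z" "y \<in> Z" "x \<le> y"
    moreover from this that obtain u v where "f x = Some u" "f y = Some v"
      by blast
    ultimately show "the (f x) \<le> the (f y)"
      using wraps_at_same[OF Y, of x u y v] that(2) by auto
  qed (rule that(1))
  show "orientation_preserving f"
  proof (cases "Y \<inter> dom f = {}")
    case True
    \<comment> \<open>No point lies before the cut, so the map is order-preserving and the cut can be moved to the
      end of the domain, giving a non-empty segment unless the map is empty.\<close>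
    then have "order_preserving_on (dom f) f" "order_preserving_on {} f"
      using op[of "dom f"] op[of "{}"] by blast+
    then show ?thesis
      unfolding orientation_preserving_def
      by (metis Diff_cancel dom_eq_empty_conv empty_iff order_refl)
  next
    case False
    moreover have "order_preserving_on (Y \<inter> dom f) f" "order_preserving_on (dom f - Y \<inter> dom f) f"
      using op[of "Y \<inter> dom f"] op[of "dom f - Y \<inter> dom f"] by blast+
    moreover have "a \<le> b \<and> the (f b) \<le> the (f a)"
      if "a \<in> Y \<inter> dom f" "b \<in> dom f - Y \<inter> dom f" for a b
      using that wraps_at_split[OF Y] by fastforce
    ultimately show ?thesis
      unfolding orientation_preserving_def by (metis inf_le2)
  qed
qed

text \<open>
  Let \<open>W\<close> consist of the points that \<open>f\<close> sends before the cut \<open>Z\<close> of \<open>g\<close>. In the domain of the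
  product, the sets \<open>Y \<inter> W\<close>, \<open>Y - W\<close>, \<open>W - Y\<close> and the rest follow each other. The first and the last
  are not both inhabited: \<open>f\<close> would send the last one below the first, but values in \<open>Z\<close> precede
  those outside. If the last is empty, the product wraps around after \<open>Y \<inter> W\<close>; if the first is
  empty, it wraps around after \<open>Y \<union> W\<close>.
\<close>

lemma wraps_at_comp:
  assumes f: "wraps_at Y f" and g: "wraps_at Z g"
  shows "\<exists>V. wraps_at V (g \<circ>\<^sub>m f)"
proof -
  define W where "W = {x. \<exists>u. f x = Some u \<and> u \<in> Z}"
  have W: "x \<in> W \<longleftrightarrow> u \<in> Z" if "f x = Some u" for x u
    using that by (auto simp: W_def)
  have not_both: False
    if "(g \<circ>\<^sub>m f) x = Some s" "(g \<circ>\<^sub>m f) y = Some t" "x \<in> Y" "x \<in> W" "y \<notin> Y" "y \<notin> W" for x y s t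
  proof -
    from that obtain u v where uv: "f x = Some u" "f y = Some v" "g u = Some s" "g v = Some t"
      by (auto simp: map_comp_Some_iff)
    then have "v \<le> u" "u \<le> v"
      using wraps_at_split[OF f uv(1,2)] wraps_at_split[OF g uv(3,4)] that W by auto
    then show False
      using that W uv by auto
  qed
  define last where "last \<longleftrightarrow> (\<exists>y t. (g \<circ>\<^sub>m f) y = Some t \<and> y \<notin> Y \<and> y \<notin> W)"
  define V where "V = (if last then Y \<union> W else Y \<inter> W)"
  have V: "x \<in> V \<longleftrightarrow> (if last then x \<in> Y \<or> x \<in> W else x \<in> Y \<and> x \<in> W)" for x
    by (simp add: V_def)
  have empty: "if last then \<not> (x \<in> Y \<and> x \<in> W) else x \<in> Y \<or> x \<in> W"
    if "(g \<circ>\<^sub>m f) x = Some s" for x s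
    using that not_both[of x s] unfolding last_def by (metis (no_types, lifting))
  have "wraps_at V (g \<circ>\<^sub>m f)"
  proof (rule wraps_atI)
    fix x y s t
    assume st: "(g \<circ>\<^sub>m f) x = Some s" "(g \<circ>\<^sub>m f) y = Some t"
    then obtain u v where uv: "f x = Some u" "f y = Some v" "g u = Some s" "g v = Some t"
      by (auto simp: map_comp_Some_iff)
    \<comment> \<open>Points that a cut separates are distinct, so only one of them is below the other.\<close>
    have strict_xy: "\<not> (x \<le> y \<and> y \<le> x)" if "(x \<in> Y) \<noteq> (y \<in> Y) \<or> (x \<in> W) \<noteq> (y \<in> W)"
      using that by auto
    have strict_uv: "\<not> (u \<le> v \<and> v \<le> u)" if "(x \<in> W) \<noteq> (y \<in> W)"
      using that W uv by auto
    note facts = wraps_at_same[OF f uv(1,2)] wraps_at_same[OF f uv(2,1)]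
      wraps_at_split[OF f uv(1,2)] wraps_at_split[OF f uv(2,1)]
      wraps_at_same[OF g uv(3,4)] wraps_at_same[OF g uv(4,3)]
      wraps_at_split[OF g uv(3,4)] wraps_at_split[OF g uv(4,3)]
      strict_xy strict_uv linear[of x y] linear[of u v]
    note rules = facts[folded W[OF uv(1)] W[OF uv(2)]] empty[OF st(1)] empty[OF st(2)]
    show "s \<le> t" if "x \<in> V \<longleftrightarrow> y \<in> V" "x \<le> y"
      using that rules unfolding V by argo
    show "x \<le> y \<and> t \<le> s" if "x \<in> V" "y \<notin> V"
      using that rules unfolding V by argo
  qed
  then show ?thesis ..
qed

text \<open>
  The values taken after the cut lie below those taken before it, so the section first runs through
  the points beyond \<open>Y\<close> and then wraps around to those in \<open>Y\<close>.
\<close>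

lemma wraps_at_map_section:
  assumes f: "wraps_at Y f"
  shows "wraps_at {y. \<exists>x. map_section f y = Some x \<and> x \<notin> Y} (map_section f)"
proof (rule wraps_atI)
  let ?V = "{y. \<exists>x. map_section f y = Some x \<and> x \<notin> Y}"
  fix y z u v
  assume yz: "map_section f y = Some u" "map_section f z = Some v"
  note uv = yz[THEN map_section_SomeD]
  show "u \<le> v" if "y \<in> ?V \<longleftrightarrow> z \<in> ?V" "y \<le> z"
  proof (rule ccontr)
    assume "\<not> u \<le> v"
    then have "z \<le> y"
      using wraps_at_same[OF f uv(2,1)] that yz by auto
    with yz \<open>\<not> u \<le> v\<close> \<open>y \<le> z\<close> show False
      by simp
  qed
  show "y \<le> z \<and> v \<le> u" if "y \<in> ?V" "z \<notin> ?V"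
    using wraps_at_split[OF f uv(2,1)] that yz by simp
qed

lemma section_closed_orientation_preserving: "section_closed orientation_preserving"
proof
  show "orientation_preserving (Some |` A)" for A :: "'a set"
  proof -
    have "wraps_at {} (Some |` A)"
      by (auto simp: wraps_at_def restrict_map_def split: if_splits)
    then show ?thesis
      unfolding orientation_preserving_iff ..
  qed
qed (use wraps_at_comp wraps_at_map_section in \<open>unfold orientation_preserving_iff, blast+\<close>)

section \<open>The four monoids\<close>

theorem proposition4p11:
  fixes X :: "'a::linorder set"
  shows "(\<forall>S\<in>{PO X, POI X}. \<forall>\<alpha>\<in>carrier S. \<forall>\<beta>\<in>carrier S.
            green_D S \<alpha> \<beta> \<longleftrightarrow> (\<exists>\<theta>. order_iso \<theta> (ran \<alpha>) (ran \<beta>))) \<and>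
         (\<forall>S\<in>{POP X, POPI X}. \<forall>\<alpha>\<in>carrier S. \<forall>\<beta>\<in>carrier S.
            green_D S \<alpha> \<beta> \<longleftrightarrow>
              (\<exists>\<theta>. partial_bij \<theta> (ran \<alpha>) (ran \<beta>) \<and> orientation_preserving \<theta>))"
proof -
  interpret PO: section_closed "order_preserving :: ('a \<rightharpoonup> 'a) \<Rightarrow> bool"
    by (rule section_closed_order_preserving)
  interpret POI: section_closed "\<lambda>f :: 'a \<rightharpoonup> 'a. order_preserving f \<and> inj_on f (dom f)"
    by (intro section_closed_injective section_closed_order_preserving)
  interpret POP: section_closed "orientation_preserving :: ('a \<rightharpoonup> 'a) \<Rightarrow> bool"
    by (rule section_closed_orientation_preserving)
  interpret POPI: section_closed "\<lambda>f :: 'a \<rightharpoonup> 'a. orientation_preserving f \<and> inj_on f (dom f)"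
    by (intro section_closed_injective section_closed_orientation_preserving)
  have PO: "PO X = PO.transformations X" and POI: "POI X = POI.transformations X"
    and POP: "POP X = POP.transformations X" and POPI: "POPI X = POPI.transformations X"
    by (simp_all add: PO_def POI_def POP_def POPI_def PO.transformations_def
        POI.transformations_def POP.transformations_def POPI.transformations_def conj_assoc)
  have inj: "partial_bij \<theta> A B \<and> Q \<and> inj_on \<theta> (dom \<theta>) \<longleftrightarrow> partial_bij \<theta> A B \<and> Q"
    for \<theta> :: "'a \<rightharpoonup> 'a" and A B Q
    by (auto simp: partial_bij_iff)
  show ?thesis
    unfolding order_iso_iff
    using PO.green_D_iff_partial_bij[of _ X, folded PO]
      POI.green_D_iff_partial_bij[of _ X, folded POI, unfolded inj]
      POP.green_D_iff_partial_bij[of _ X, folded POP]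
      POPI.green_D_iff_partial_bij[of _ X, folded POPI, unfolded inj]
    by blast
qed

end
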